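(* Let $m,n$ be positive integers with $n\ge 15$, $m\ge 9$ and $m-1\mid n-5$. Let $G_m\in\{P_m,T_m',T_m^*,T_m^1,T_m^2,T_m^3,T_m'',T_m'''\}$ and $T_n\in\{T_n'',T_n''',T_n^3\}$. Then $r(G_m,T_n)=m+n-5$.
   Context: All graphs are finite simple graphs. For graphs $G_1,G_2$, the Ramsey number $r(G_1,G_2)$ is the smallest positive integer $N$ such that for every graph $G$ on $N$ vertices, either $G$ contains a (not necessarily induced) subgraph isomorphic to $G_1$, or the complement $\overline{G}$ contains a subgraph isomorphic to $G_2$. $P_k$ is the path on $k$ vertices. For a tree on $k$ vertices, take vertex set $\{v_0,\ldots,v_{k-1}\}$. $T_k'$ ($k\ge4$) is the unique tree on $k$ vertices with maximum degree $k-2$ (edges $v_0v_1,\ldots,v_0v_{k-2},v_{k-2}v_{k-1}$). $T_k^*$: edges $v_0v_1,\ldots,v_0v_{k-3},v_{k-3}v_{k-2},v_{k-2}v_{k-1}$. $T_k^1$: edges $v_0v_1,\ldots,v_0v_{k-3},v_{k-4}v_{k-2},v_{k-3}v_{k-1}$. $T_k^2$: edges $v_0v_1,\ldots,v_0v_{k-3},v_{k-3}v_{k-2},v_{k-3}v_{k-1}$. $T_k^3$: edges $v_0v_1,\ldots,v_0v_{k-4},v_{k-4}v_{k-3},v_{k-4}v_{k-2},v_{k-4}v_{k-1}$. $T_k''$: edges $v_0v_1,\ldots,v_0v_{k-4},v_1v_{k-3},v_1v_{k-2},v_2v_{k-1}$. $T_k'''$: edges $v_0v_1,\ldots,v_0v_{k-4},v_1v_{k-3},v_2v_{k-2},v_3v_{k-1}$.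 *)

theory Defs
  imports Main "HOL-Library.Ramsey"
begin

record 'a graph =
  verts :: "'a set"
  edges :: "'a set set"

text \<open>Finite simple graphs; \<open>[V]\<^bsup>2\<^esup>\<close> (the library's \<^const>\<open>nsets\<close>) is the set of
  2-element subsets of \<open>V\<close>.\<close>

definition simple_graph :: "'a graph \<Rightarrow> bool" where
  "simple_graph G \<longleftrightarrow> finite (verts G) \<and> edges G \<subseteq> nsets (verts G) 2"

definition complement :: "'a graph \<Rightarrow> 'a graph" where
  "complement G = \<lparr>verts = verts G, edges = nsets (verts G) 2 - edges G\<rparr>"

definition subgraph :: "'a graph \<Rightarrow> 'a graph \<Rightarrow> bool" where
  "subgraph H G \<longleftrightarrow> simple_graph H \<and> verts H \<subseteq> verts G \<and> edges H \<subseteq> edges G"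

definition isomorphic :: "'a graph \<Rightarrow> 'b graph \<Rightarrow> bool" where
  "isomorphic G H \<longleftrightarrow> (\<exists>f. bij_betw f (verts G) (verts H) \<and>
     (\<forall>u\<in>verts G. \<forall>v\<in>verts G. {u, v} \<in> edges G \<longleftrightarrow> {f u, f v} \<in> edges H))"

definition contains_copy :: "'a graph \<Rightarrow> 'b graph \<Rightarrow> bool" where
  "contains_copy G H \<longleftrightarrow> (\<exists>H'. subgraph H' G \<and> isomorphic H' H)"

text \<open>Every finite graph is isomorphic to one whose vertices are natural numbers, so
  letting \<open>G\<close> range over graphs on \<^typ>\<open>nat\<close> loses no generality.\<close>

definition ramsey_number :: "'a graph \<Rightarrow> 'b graph \<Rightarrow> nat" where
  "ramsey_number G1 G2 = (LEAST N. N > 0 \<and>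
     (\<forall>G :: nat graph. simple_graph G \<and> card (verts G) = N \<longrightarrow>
        contains_copy G G1 \<or> contains_copy (complement G) G2))"

text \<open>Trees on \<open>k\<close> vertices; the vertex \<open>v\<^sub>i\<close> is the number \<open>i\<close>. The definitions below are
  meaningful only for \<open>k\<close> large enough that the listed edges make sense (\<open>k \<ge> 7\<close> suffices
  for all of them).\<close>

definition path_P :: "nat \<Rightarrow> nat graph" where
  "path_P k = \<lparr>verts = {0..<k}, edges = {{i, Suc i} | i. Suc i < k}\<rparr>"

definition star_edges :: "nat \<Rightarrow> nat set set" where
  "star_edges d = {{0, i} | i. 1 \<le> i \<and> i \<le> d}"

definition tree_prime :: "nat \<Rightarrow> nat graph" where \<comment> \<open>\<open>T'\<close>\<close>
  "tree_prime k = \<lparr>verts = {0..<k}, edges = star_edges (k - 2) \<union> {{k - 2, k - 1}}\<rparr>"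

definition tree_star :: "nat \<Rightarrow> nat graph" where \<comment> \<open>\<open>T\<^sup>*\<close>\<close>
  "tree_star k = \<lparr>verts = {0..<k},
     edges = star_edges (k - 3) \<union> {{k - 3, k - 2}, {k - 2, k - 1}}\<rparr>"

definition tree_1 :: "nat \<Rightarrow> nat graph" where \<comment> \<open>\<open>T\<^sup>1\<close>\<close>
  "tree_1 k = \<lparr>verts = {0..<k},
     edges = star_edges (k - 3) \<union> {{k - 4, k - 2}, {k - 3, k - 1}}\<rparr>"

definition tree_2 :: "nat \<Rightarrow> nat graph" where \<comment> \<open>\<open>T\<^sup>2\<close>\<close>
  "tree_2 k = \<lparr>verts = {0..<k},
     edges = star_edges (k - 3) \<union> {{k - 3, k - 2}, {k - 3, k - 1}}\<rparr>"

definition tree_3 :: "nat \<Rightarrow> nat graph" where \<comment> \<open>\<open>T\<^sup>3\<close>\<close>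
  "tree_3 k = \<lparr>verts = {0..<k},
     edges = star_edges (k - 4) \<union> {{k - 4, k - 3}, {k - 4, k - 2}, {k - 4, k - 1}}\<rparr>"

definition tree_prime2 :: "nat \<Rightarrow> nat graph" where \<comment> \<open>\<open>T''\<close>\<close>
  "tree_prime2 k = \<lparr>verts = {0..<k},
     edges = star_edges (k - 4) \<union> {{1, k - 3}, {1, k - 2}, {2, k - 1}}\<rparr>"

definition tree_prime3 :: "nat \<Rightarrow> nat graph" where \<comment> \<open>\<open>T'''\<close>\<close>
  "tree_prime3 k = \<lparr>verts = {0..<k},
     edges = star_edges (k - 4) \<union> {{1, k - 3}, {2, k - 2}, {3, k - 1}}\<rparr>"

end

theory Submission
  imports Defs
begin

text \<open>Lower bound: the \<open>m + n - 6\<close> vertices split into disjoint cliques of size \<open>m - 1\<close>; these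
  contain no connected graph on \<open>m\<close> vertices, and the complement is regular of degree \<open>n - 5\<close>,
  whereas \<open>T\<close> has a vertex of degree \<open>n - 4\<close>.

  Upper bound: let \<open>K\<close> have \<open>m + n - 5\<close> vertices. If the complement has maximum degree at most
  \<open>n - 5\<close>, then \<open>K\<close> has minimum degree at least \<open>m - 1\<close> and every tree on \<open>m\<close> vertices embeds
  greedily. Otherwise take \<open>n - 4\<close> neighbours \<open>A\<close> of a vertex \<open>v\<close> in the complement, and let \<open>B\<close>
  be the remaining \<open>m - 2\<close> vertices. If the complement contains no \<open>T\<close>, then for some \<open>j \<le> 2\<close>
  there are \<open>m - 2 + j\<close> vertices of \<open>A\<close>, each adjacent in \<open>K\<close> to all but at most \<open>j\<close> vertices of
  \<open>B\<close>. Double counting yields a vertex \<open>c\<close> of \<open>B\<close> adjacent in \<open>K\<close> to \<open>m - 2\<close> of them, and the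
  resulting almost complete bipartite graph contains all the listed trees on \<open>m\<close> vertices:
  those other than the path have \<open>v\<^sub>0\<close> at \<open>c\<close>.\<close>

section \<open>Copies as injective edge-preserving maps\<close>

text \<open>The copy is the image of \<open>H\<close> under \<open>f\<close>, which need not be
  induced in \<open>G\<close>. Taking images is injective on subsets of \<open>verts H\<close>, so
  the image has no edges besides those coming from \<open>H\<close>.\<close>

lemma contains_copyI:
  assumes H: "simple_graph H" and inj: "inj_on f (verts H)" and V: "f ` verts H \<subseteq> verts G"
    and E: "\<And>e. e \<in> edges H \<Longrightarrow> f ` e \<in> edges G"
  shows "contains_copy G H"
proof -
  define H' where "H' = \<lparr>verts = f ` verts H, edges = (`) f ` edges H\<rparr>"
  have sub: "e \<subseteq> verts H" "finite e" "card e = 2" if "e \<in> edges H" for e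
    using H that by (auto simp: simple_graph_def nsets_def)
  have "edges H' \<subseteq> nsets (verts H') 2"
    using sub by (auto simp: H'_def nsets_def card_image inj_on_subset[OF inj])
  hence "subgraph H' G"
    using H V E by (auto simp: subgraph_def simple_graph_def H'_def)
  moreover have "isomorphic H' H"
    unfolding isomorphic_def
  proof (intro exI conjI ballI)
    show "bij_betw (the_inv_into (verts H) f) (verts H') (verts H)"
      using bij_betw_the_inv_into[OF inj_on_imp_bij_betw[OF inj]] by (simp add: H'_def)
  next
    fix u v assume "u \<in> verts H'" "v \<in> verts H'"
    then obtain x y where xy: "u = f x" "v = f y" "x \<in> verts H" "y \<in> verts H"
      by (auto simp: H'_def)
    have "f ` {x, y} \<in> (`) f ` edges H \<longleftrightarrow> {x, y} \<in> edges H"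
    proof
      assume "f ` {x, y} \<in> (`) f ` edges H"
      then obtain e where e: "e \<in> edges H" "f ` {x, y} = f ` e" by blast
      hence "{x, y} = e"
        using inj_on_image_eq_iff[OF inj, of "{x, y}" e] sub xy by blast
      thus "{x, y} \<in> edges H" using e by simp
    qed blast
    thus "{u, v} \<in> edges H' \<longleftrightarrow>
        {the_inv_into (verts H) f u, the_inv_into (verts H) f v} \<in> edges H"
      using xy inj by (simp add: H'_def the_inv_into_f_f)
  qed
  ultimately show ?thesis unfolding contains_copy_def by blast
qed

lemma contains_copyE:
  assumes "contains_copy G H"
  obtains f where "inj_on f (verts H)" "f ` verts H \<subseteq> verts G"
    "\<And>u v. u \<in> verts H \<Longrightarrow> v \<in> verts H \<Longrightarrow> {u, v} \<in> edges H \<Longrightarrow> {f u, f v} \<in> edges G"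
proof -
  from assms obtain H' g where H': "subgraph H' G" "bij_betw g (verts H') (verts H)"
    and iso: "\<And>u v. u \<in> verts H' \<Longrightarrow> v \<in> verts H' \<Longrightarrow> {u, v} \<in> edges H' \<longleftrightarrow> {g u, g v} \<in> edges H"
    unfolding contains_copy_def isomorphic_def by blast
  let ?f = "inv_into (verts H') g"
  have bij: "bij_betw ?f (verts H) (verts H')" by (rule bij_betw_inv_into[OF H'(2)])
  have mem: "?f u \<in> verts H'" if "u \<in> verts H" for u using bij that by (auto simp: bij_betw_def)
  have gf: "g (?f u) = u" if "u \<in> verts H" for u
    using bij_betw_inv_into_right[OF H'(2) that] .
  show thesis
  proof
    show "inj_on ?f (verts H)" using bij by (rule bij_betw_imp_inj_on)
    show "?f ` verts H \<subseteq> verts G" using bij H'(1) by (auto simp: bij_betw_def subgraph_def)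
    fix u v assume "u \<in> verts H" "v \<in> verts H" "{u, v} \<in> edges H"
    hence "{?f u, ?f v} \<in> edges H'" using iso mem gf by simp
    thus "{?f u, ?f v} \<in> edges G" using H'(1) by (auto simp: subgraph_def)
  qed
qed

section \<open>Trees grown vertex by vertex\<close>

text \<open>Attaching each vertex \<open>i > 0\<close> to an earlier vertex \<open>par i\<close>
  encodes a tree so that greedy embedding and connectedness arguments both become inductions on the
  vertex number.\<close>

definition grown_tree :: "nat \<Rightarrow> nat graph \<Rightarrow> bool" where
  "grown_tree k H \<longleftrightarrow> verts H = {0..<k} \<and>
     (\<exists>par. (\<forall>i\<in>{1..<k}. par i < i) \<and> edges H = (\<lambda>i. {par i, i}) ` {1..<k})"

lemma grown_treeI:
  assumes "verts H = {0..<k}" "\<And>i. 1 \<le> i \<Longrightarrow> i < k \<Longrightarrow> par i < i"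
    and "edges H = (\<lambda>i. {par i, i}) ` {1..<k}"
  shows "grown_tree k H"
  unfolding grown_tree_def using assms by (intro conjI exI[of _ par]) auto

lemma simple_graph_grown_tree: "grown_tree k H \<Longrightarrow> simple_graph H"
  by (force simp: grown_tree_def simple_graph_def nsets_def card_insert_if)

lemma star_edges_conv: "star_edges d = (\<lambda>i. {0, i}) ` {1..d}"
  by (auto simp: star_edges_def)

lemma star_edges_grow:
  assumes "d < k"
  shows "(\<lambda>i. {if i \<le> d then 0 else q i, i}) ` {1..<k} =
    star_edges d \<union> (\<lambda>i. {q i, i}) ` {d<..<k}"
proof -
  have "{1..<k} = {1..d} \<union> {d<..<k}" using assms by auto
  thus ?thesis by (simp add: image_Un star_edges_conv cong: image_cong_simp)
qed

text \<open>In every listed tree except the path, the neighbours of vertex 0 are numbered first, so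
  only the parents of the few vertices beyond \<open>d\<close> have to be named.\<close>

lemma grown_tree_star:
  assumes "verts H = {0..<k}" "d < k" "\<And>i. d < i \<Longrightarrow> i < k \<Longrightarrow> q i < i"
    and "edges H = star_edges d \<union> (\<lambda>i. {q i, i}) ` {d<..<k}"
  shows "grown_tree k H"
  using assms star_edges_grow[of d k q]
  by (intro grown_treeI[where par = "\<lambda>i. if i \<le> d then 0 else q i"]) auto

lemma grown_tree_path_P: "grown_tree k (path_P k)"
proof (rule grown_treeI[where par = "\<lambda>i. i - 1"])
  show "edges (path_P k) = (\<lambda>i. {i - 1, i}) ` {1..<k}"
  proof -
    have "{1..<k} = Suc ` {i. Suc i < k}" by (auto simp: image_iff Suc_le_eq gr0_conv_Suc)
    thus ?thesis by (auto simp: path_P_def image_image)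
  qed
qed (auto simp: path_P_def)

lemma grown_tree_trees:
  assumes "7 \<le> k"
  shows "grown_tree k (tree_prime k)" "grown_tree k (tree_star k)" "grown_tree k (tree_1 k)"
    "grown_tree k (tree_2 k)" "grown_tree k (tree_3 k)" "grown_tree k (tree_prime2 k)"
    "grown_tree k (tree_prime3 k)"
proof -
  \<comment> \<open>This turns each \<open>k - i\<close> into an explicit sum. The bound 7 is what
    places the vertices 1, 2, 3 in the star of \<open>tree_prime3\<close>.\<close>
  obtain r where k: "k = r + 7" using assms by (metis le_add_diff_inverse2)
  have I: "{r + 5<..<r + 7} = {r + 6}" "{r + 4<..<r + 7} = {r + 5, r + 6}"
    "{r + 3<..<r + 7} = {r + 4, r + 5, r + 6}" by auto
  show "grown_tree k (tree_prime k)"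
    by (rule grown_tree_star[where d = "r + 5" and q = "\<lambda>i. r + 5"])
      (simp_all add: k add.commute insert_commute tree_prime_def I)
  show "grown_tree k (tree_star k)"
    by (rule grown_tree_star[where d = "r + 4" and q = "\<lambda>i. i - 1"])
      (simp_all add: k add.commute insert_commute tree_star_def I)
  show "grown_tree k (tree_1 k)"
    by (rule grown_tree_star[where d = "r + 4" and q = "\<lambda>i. i - 2"])
      (simp_all add: k add.commute insert_commute tree_1_def I)
  show "grown_tree k (tree_2 k)"
    by (rule grown_tree_star[where d = "r + 4" and q = "\<lambda>i. r + 4"])
      (simp_all add: k add.commute insert_commute tree_2_def I)
  show "grown_tree k (tree_3 k)"
    by (rule grown_tree_star[where d = "r + 3" and q = "\<lambda>i. r + 3"])
      (simp_all add: k add.commute insert_commute tree_3_def I)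
  show "grown_tree k (tree_prime2 k)"
    by (rule grown_tree_star[where d = "r + 3" and q = "\<lambda>i. if i = r + 6 then 2 else 1"])
      (simp_all add: k add.commute insert_commute tree_prime2_def I)
  show "grown_tree k (tree_prime3 k)"
    by (rule grown_tree_star[where d = "r + 3" and q = "\<lambda>i. i - (r + 3)"])
      (simp_all add: k add.commute insert_commute tree_prime3_def I)
qed

text \<open>Greedy embedding: fewer than \<open>k\<close> vertices are occupied when vertex
  \<open>j\<close> is placed, while the closed neighbourhood of its parent's image has at least
  \<open>k\<close>.\<close>

lemma grown_tree_copy_if_min_degree:
  assumes H: "grown_tree k H" and K: "simple_graph K" "verts K \<noteq> {}"
    and deg: "\<And>x. x \<in> verts K \<Longrightarrow> k - 1 \<le> card {y \<in> verts K. {x, y} \<in> edges K}"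
  shows "contains_copy K H"
proof -
  from H obtain par where V: "verts H = {0..<k}" and par: "\<And>i. 1 \<le> i \<Longrightarrow> i < k \<Longrightarrow> par i < i"
    and E: "edges H = (\<lambda>i. {par i, i}) ` {1..<k}"
    unfolding grown_tree_def by (metis atLeastLessThan_iff)
  have "j \<le> k \<Longrightarrow> \<exists>f. inj_on f {0..<j} \<and> f ` {0..<j} \<subseteq> verts K \<and>
      (\<forall>i\<in>{1..<j}. {f (par i), f i} \<in> edges K)" for j
  proof (induction j)
    case (Suc j)
    then obtain f where f: "inj_on f {0..<j}" "f ` {0..<j} \<subseteq> verts K"
        "\<forall>i\<in>{1..<j}. {f (par i), f i} \<in> edges K" by auto
    obtain y where y: "y \<in> verts K" "y \<notin> f ` {0..<j}" "j \<ge> 1 \<Longrightarrow> {f (par j), y} \<in> edges K"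
    proof (cases "j = 0")
      case True
      thus thesis using K(2) that by auto
    next
      case False
      let ?x = "f (par j)" and ?N = "{y \<in> verts K. {f (par j), y} \<in> edges K}"
      have p: "par j < j" using par False Suc.prems by auto
      hence x: "?x \<in> verts K" using f(2) by auto
      \<comment> \<open>Since \<open>?x\<close> is itself occupied, a free vertex of the closed
        neighbourhood is a genuine neighbour of \<open>?x\<close>.\<close>
      have "?x \<notin> ?N" using K(1) by (auto simp: simple_graph_def nsets_def)
      hence "card (insert ?x ?N) \<ge> k"
        using deg[OF x] K(1) Suc.prems by (simp add: simple_graph_def)
      moreover have "card (f ` {0..<j}) < k"
        using card_image_le[of "{0..<j}" f] Suc.prems by simp
      ultimately have "\<not> insert ?x ?N \<subseteq> f ` {0..<j}"
        using card_mono[of "f ` {0..<j}" "insert ?x ?N"] by auto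
      moreover have "?x \<in> f ` {0..<j}" using p by auto
      ultimately show thesis using that by auto
    qed
    have eq: "(f(j := y)) i = f i" if "i < j" for i using that by simp
    have "inj_on (f(j := y)) {0..<Suc j}"
      using f(1) y(2) by (auto simp: atLeast0_lessThan_Suc inj_on_def)
    moreover have "(f(j := y)) ` {0..<Suc j} \<subseteq> verts K"
      using f(2) y(1) by (auto simp: atLeast0_lessThan_Suc)
    moreover have "{(f(j := y)) (par i), (f(j := y)) i} \<in> edges K" if "i \<in> {1..<Suc j}" for i
    proof (cases "i = j")
      case True
      thus ?thesis using par[of j] Suc.prems that y(3) by auto
    next
      case False
      thus ?thesis using par[of i] Suc.prems that f(3) by auto
    qed
    ultimately show ?case by blast
  qed simp
  from this[of k] obtain f where f: "inj_on f {0..<k}" "f ` {0..<k} \<subseteq> verts K"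
      "\<forall>i\<in>{1..<k}. {f (par i), f i} \<in> edges K" by auto
  show ?thesis
    by (rule contains_copyI[OF simple_graph_grown_tree[OF H], of f]) (use f V E in auto)
qed

section \<open>Trees built on a large star\<close>

text \<open>The embedding is a list whose entry at position \<open>i\<close> is the image of vertex
  \<open>i\<close>: the hub, its neighbours, then the rest. Injectivity is distinctness of the list,
  and only the edges in \<open>X\<close> need separate care.\<close>

lemma star_tree_copy:
  assumes H: "simple_graph H" "verts H = {0..<length (c # as @ bs)}"
      "edges H = star_edges (length as) \<union> X"
    and vs: "distinct (c # as @ bs)" "set (c # as @ bs) \<subseteq> verts K"
    and star: "\<And>a. a \<in> set as \<Longrightarrow> {c, a} \<in> edges K"
    and X: "\<And>e. e \<in> X \<Longrightarrow> (!) (c # as @ bs) ` e \<in> edges K"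
  shows "contains_copy K H"
proof (rule contains_copyI[OF H(1), of "(!) (c # as @ bs)"])
  let ?vs = "c # as @ bs"
  show "inj_on ((!) ?vs) (verts H)"
    using vs(1) H(2) by (auto intro!: inj_on_nth)
  show "(!) ?vs ` verts H \<subseteq> verts K"
  proof (rule image_subsetI)
    fix i assume "i \<in> verts H"
    hence "?vs ! i \<in> set ?vs" using H(2) by (intro nth_mem) simp
    thus "?vs ! i \<in> verts K" using vs(2) by blast
  qed
  fix e assume e: "e \<in> edges H"
  show "(!) ?vs ` e \<in> edges K"
  proof (cases "e \<in> X")
    case False
    then obtain i where i: "e = {0, Suc i}" "i < length as"
      using e H(3) by (auto simp: star_edges_def Suc_le_eq dest: gr0_implies_Suc)
    thus ?thesis using star[of "as ! i"] by (simp add: nth_append)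
  qed (rule X)
qed

text \<open>Serves both sides: in \<open>K\<close> to embed the trees on \<open>m\<close> vertices,
  and in the complement to see what the absence of \<open>T\<close> forces. \<open>A\<close> is the
  full set of images of the neighbours of vertex 0, so its size must be the degree of that
  vertex.\<close>

locale star_in_graph =
  fixes K :: "'a graph" and c :: 'a and A :: "'a set"
  assumes fin: "finite A" and c_notin: "c \<notin> A" and verts: "insert c A \<subseteq> verts K"
    and star: "\<And>a. a \<in> A \<Longrightarrow> {c, a} \<in> edges K"
begin

text \<open>Both orders are provided because some trees continue from the last star vertices and
  others from the vertices 1, 2, 3.\<close>

lemma list_of_rest:
  assumes "distinct ys" "set ys \<subseteq> A" "card A = r + length ys"
  obtains xs where "distinct (xs @ ys)" "set (xs @ ys) = A" "distinct (ys @ xs)"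
    "set (ys @ xs) = A" "length xs = r"
proof -
  have "card (A - set ys) = r"
    using assms by (simp add: card_Diff_subset distinct_card)
  then obtain xs where "set xs = A - set ys" "distinct xs" "length xs = r"
    using finite_distinct_list[of "A - set ys"] fin distinct_card by (metis finite_Diff)
  thus thesis using assms by (intro that[of xs]) auto
qed

lemma hub_copy:
  assumes "grown_tree k H" "verts H = {0..<k}" "edges H = star_edges d \<union> X"
    and "length as = d" "k = Suc (d + length bs)" "distinct as" "set as = A" "distinct bs"
    and "set bs \<subseteq> verts K - insert c A"
    and "\<forall>e\<in>X. (!) (c # as @ bs) ` e \<in> edges K"
  shows "contains_copy K H"
  by (rule star_tree_copy[of H c as bs X])
    (use assms c_notin verts star simple_graph_grown_tree in auto)

context
  fixes k :: nat
  assumes k: "7 \<le> k"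
begin

lemma k_conv: obtains r where "k = 7 + r"
  using k by (metis le_add_diff_inverse)

lemma tree_prime_copy:
  assumes "card A = k - 2" "a \<in> A" "b \<in> verts K - insert c A" "{a, b} \<in> edges K"
  shows "contains_copy K (tree_prime k)"
proof -
  obtain r where r: "k = 7 + r" by (rule k_conv)
  obtain xs where xs: "distinct (xs @ [a])" "set (xs @ [a]) = A" "distinct ([a] @ xs)"
      "set ([a] @ xs) = A" "length xs = 4 + r"
    by (rule list_of_rest[of "[a]" "4 + r"]) (use assms r in auto)
  \<comment> \<open>Positions \<open>k - 2\<close> and \<open>k - 1\<close> of the list. The other
    trees are treated in the same way: \<open>N\<close> evaluates the list at those endpoints of the
    extra edges whose position depends on \<open>k\<close>.\<close>
  have N: "(c # xs @ [a, b]) ! (5 + r) = a"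
    "(c # xs @ [a, b]) ! (6 + r) = b"
    using xs(5) by (simp_all add: nth_Cons' nth_append)
  show ?thesis
    by (rule hub_copy[where d = "k - 2" and as = "xs @ [a]" and bs = "[b]" and X = "{{k - 2, k - 1}}",
          OF grown_tree_trees(1)[OF k]],
        simp add: tree_prime_def, simp add: tree_prime_def, insert assms xs(1-4), auto simp: r N xs(5))
qed

lemma tree_star_copy:
  assumes "card A = k - 3" "a \<in> A" "distinct [b, b']" "{b, b'} \<subseteq> verts K - insert c A"
    and "{a, b} \<in> edges K" "{b, b'} \<in> edges K"
  shows "contains_copy K (tree_star k)"
proof -
  obtain r where r: "k = 7 + r" by (rule k_conv)
  obtain xs where xs: "distinct (xs @ [a])" "set (xs @ [a]) = A" "distinct ([a] @ xs)"
      "set ([a] @ xs) = A" "length xs = 3 + r"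
    by (rule list_of_rest[of "[a]" "3 + r"]) (use assms r in auto)
  have N: "(c # xs @ [a, b, b']) ! (4 + r) = a"
    "(c # xs @ [a, b, b']) ! (5 + r) = b"
    "(c # xs @ [a, b, b']) ! (6 + r) = b'"
    using xs(5) by (simp_all add: nth_Cons' nth_append)
  show ?thesis
    by (rule hub_copy[where d = "k - 3" and as = "xs @ [a]" and bs = "[b, b']"
          and X = "{{k - 3, k - 2}, {k - 2, k - 1}}", OF grown_tree_trees(2)[OF k]],
        simp add: tree_star_def, simp add: tree_star_def, insert assms xs(1-4), auto simp: r N xs(5))
qed

lemma tree_1_copy:
  assumes "card A = k - 3" "distinct [a, a']" "{a, a'} \<subseteq> A"
    and "distinct [b, b']" "{b, b'} \<subseteq> verts K - insert c A"
    and "{a, b} \<in> edges K" "{a', b'} \<in> edges K"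
  shows "contains_copy K (tree_1 k)"
proof -
  obtain r where r: "k = 7 + r" by (rule k_conv)
  obtain xs where xs: "distinct (xs @ [a, a'])" "set (xs @ [a, a']) = A" "distinct ([a, a'] @ xs)"
      "set ([a, a'] @ xs) = A" "length xs = 2 + r"
    by (rule list_of_rest[of "[a, a']" "2 + r"]) (use assms r in auto)
  have N: "(c # xs @ [a, a', b, b']) ! (3 + r) = a"
    "(c # xs @ [a, a', b, b']) ! (4 + r) = a'"
    "(c # xs @ [a, a', b, b']) ! (5 + r) = b"
    "(c # xs @ [a, a', b, b']) ! (6 + r) = b'"
    using xs(5) by (simp_all add: nth_Cons' nth_append)
  show ?thesis
    by (rule hub_copy[where d = "k - 3" and as = "xs @ [a, a']" and bs = "[b, b']"
          and X = "{{k - 4, k - 2}, {k - 3, k - 1}}", OF grown_tree_trees(3)[OF k]],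
        simp add: tree_1_def, simp add: tree_1_def, insert assms xs(1-4), auto simp: r N xs(5))
qed

lemma tree_2_copy:
  assumes "card A = k - 3" "a \<in> A" "distinct [b, b']" "{b, b'} \<subseteq> verts K - insert c A"
    and "{a, b} \<in> edges K" "{a, b'} \<in> edges K"
  shows "contains_copy K (tree_2 k)"
proof -
  obtain r where r: "k = 7 + r" by (rule k_conv)
  obtain xs where xs: "distinct (xs @ [a])" "set (xs @ [a]) = A" "distinct ([a] @ xs)"
      "set ([a] @ xs) = A" "length xs = 3 + r"
    by (rule list_of_rest[of "[a]" "3 + r"]) (use assms r in auto)
  have N: "(c # xs @ [a, b, b']) ! (4 + r) = a"
    "(c # xs @ [a, b, b']) ! (5 + r) = b"
    "(c # xs @ [a, b, b']) ! (6 + r) = b'"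
    using xs(5) by (simp_all add: nth_Cons' nth_append)
  show ?thesis
    by (rule hub_copy[where d = "k - 3" and as = "xs @ [a]" and bs = "[b, b']"
          and X = "{{k - 3, k - 2}, {k - 3, k - 1}}", OF grown_tree_trees(4)[OF k]],
        simp add: tree_2_def, simp add: tree_2_def, insert assms xs(1-4), auto simp: r N xs(5))
qed

lemma tree_3_copy:
  assumes "card A = k - 4" "a \<in> A" "distinct [b1, b2, b3]"
    and "{b1, b2, b3} \<subseteq> verts K - insert c A"
    and "{a, b1} \<in> edges K" "{a, b2} \<in> edges K" "{a, b3} \<in> edges K"
  shows "contains_copy K (tree_3 k)"
proof -
  obtain r where r: "k = 7 + r" by (rule k_conv)
  obtain xs where xs: "distinct (xs @ [a])" "set (xs @ [a]) = A" "distinct ([a] @ xs)"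
      "set ([a] @ xs) = A" "length xs = 2 + r"
    by (rule list_of_rest[of "[a]" "2 + r"]) (use assms r in auto)
  have N: "(c # xs @ [a, b1, b2, b3]) ! (3 + r) = a"
    "(c # xs @ [a, b1, b2, b3]) ! (4 + r) = b1"
    "(c # xs @ [a, b1, b2, b3]) ! (5 + r) = b2"
    "(c # xs @ [a, b1, b2, b3]) ! (6 + r) = b3"
    using xs(5) by (simp_all add: nth_Cons' nth_append)
  show ?thesis
    by (rule hub_copy[where d = "k - 4" and as = "xs @ [a]" and bs = "[b1, b2, b3]"
          and X = "{{k - 4, k - 3}, {k - 4, k - 2}, {k - 4, k - 1}}", OF grown_tree_trees(5)[OF k]],
        simp add: tree_3_def, simp add: tree_3_def, insert assms xs(1-4), auto simp: r N xs(5))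
qed

lemma tree_prime2_copy:
  assumes "card A = k - 4" "distinct [a1, a2]" "{a1, a2} \<subseteq> A" "distinct [b1, b2, b3]"
    and "{b1, b2, b3} \<subseteq> verts K - insert c A"
    and "{a1, b1} \<in> edges K" "{a1, b2} \<in> edges K" "{a2, b3} \<in> edges K"
  shows "contains_copy K (tree_prime2 k)"
proof -
  obtain r where r: "k = 7 + r" by (rule k_conv)
  obtain xs where xs: "distinct (xs @ [a1, a2])" "set (xs @ [a1, a2]) = A" "distinct ([a1, a2] @ xs)"
      "set ([a1, a2] @ xs) = A" "length xs = 1 + r"
    by (rule list_of_rest[of "[a1, a2]" "1 + r"]) (use assms r in auto)
  have N: "(c # a1 # a2 # xs @ [b1, b2, b3]) ! (4 + r) = b1"
    "(c # a1 # a2 # xs @ [b1, b2, b3]) ! (5 + r) = b2"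
    "(c # a1 # a2 # xs @ [b1, b2, b3]) ! (6 + r) = b3"
    using xs(5) by (simp_all add: nth_Cons' nth_append)
  show ?thesis
    by (rule hub_copy[where d = "k - 4" and as = "a1 # a2 # xs" and bs = "[b1, b2, b3]"
          and X = "{{1, k - 3}, {1, k - 2}, {2, k - 1}}", OF grown_tree_trees(6)[OF k]],
        simp add: tree_prime2_def, simp add: tree_prime2_def, insert assms xs(1-4), auto simp: r N xs(5))
qed

lemma tree_prime3_copy:
  assumes "card A = k - 4" "distinct [a1, a2, a3]" "{a1, a2, a3} \<subseteq> A" "distinct [b1, b2, b3]"
    and "{b1, b2, b3} \<subseteq> verts K - insert c A"
    and "{a1, b1} \<in> edges K" "{a2, b2} \<in> edges K" "{a3, b3} \<in> edges K"
  shows "contains_copy K (tree_prime3 k)"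
proof -
  obtain r where r: "k = 7 + r" by (rule k_conv)
  obtain xs where xs: "distinct (xs @ [a1, a2, a3])" "set (xs @ [a1, a2, a3]) = A" "distinct ([a1, a2, a3] @ xs)"
      "set ([a1, a2, a3] @ xs) = A" "length xs = r"
    by (rule list_of_rest[of "[a1, a2, a3]" r]) (use assms r in auto)
  have N: "(c # a1 # a2 # a3 # xs @ [b1, b2, b3]) ! (4 + r) = b1"
    "(c # a1 # a2 # a3 # xs @ [b1, b2, b3]) ! (5 + r) = b2"
    "(c # a1 # a2 # a3 # xs @ [b1, b2, b3]) ! (6 + r) = b3"
    using xs(5) by (simp_all add: nth_Cons' nth_append)
  show ?thesis
    by (rule hub_copy[where d = "k - 4" and as = "a1 # a2 # a3 # xs" and bs = "[b1, b2, b3]"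
          and X = "{{1, k - 3}, {2, k - 2}, {3, k - 1}}", OF grown_tree_trees(7)[OF k]],
        simp add: tree_prime3_def, simp add: tree_prime3_def, insert assms xs(1-4), auto simp: r N xs(5))
qed

end

lemma star_in_graph_subset: "S \<subseteq> A \<Longrightarrow> star_in_graph K c S"
  using fin c_notin verts star by unfold_locales (auto intro: finite_subset)

text \<open>Each \<open>T\<close> has three edges beyond its star, so star vertices with too many
  neighbours outside the star complete a copy. The number \<open>j\<close> trades size for sparsity:
  each further neighbour allowed is paid for by one more vertex in \<open>S\<close>.\<close>

lemma sparse_leaves_if_tree_free:
  assumes k: "7 \<le> k" "card A = k - 4" and fin_verts: "finite (verts K)"
    and T: "T \<in> {tree_prime2 k, tree_prime3 k, tree_3 k}" "\<not> contains_copy K T"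
  obtains S j where "S \<subseteq> A" "j \<le> 2" "card S = k - 6 + j"
    "\<And>a. a \<in> S \<Longrightarrow> card {b \<in> verts K - insert c A. {a, b} \<in> edges K} \<le> j"
proof -
  define D where "D a = {b \<in> verts K - insert c A. {a, b} \<in> edges K}" for a
  have fin_D: "finite (D a)" for a using fin_verts by (simp add: D_def)
  have D: "b \<in> D a \<longleftrightarrow> b \<in> verts K - insert c A \<and> {a, b} \<in> edges K" for a b
    by (auto simp: D_def)
  note witness = that
  have enough: thesis if S: "S \<subseteq> A" "j \<le> 2" "k - 6 + j \<le> card S" "\<And>a. a \<in> S \<Longrightarrow> card (D a) \<le> j" for S j
  proof -
    obtain S' where "S' \<subseteq> S" "card S' = k - 6 + j"
      using obtain_subset_with_card_n[OF S(3)] by metis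
    thus thesis using S by (intro witness[of S' j]) (auto simp: D_def)
  qed
  have avoid: "\<exists>b. b \<in> D a \<and> b \<notin> X" if "card X < card (D a)" "finite X" for a X
    using that card_mono[of X "D a"] by (meson leD subsetI)
  show thesis
  proof (cases "\<forall>a\<in>A. card (D a) \<le> 2")
    case True
    thus thesis using k by (intro enough[of A 2]) auto
  next
    case False
    \<comment> \<open>Three outside neighbours of \<open>a1\<close> already give
      \<open>tree_3\<close>, which leaves the other two trees.\<close>
    then obtain a1 where a1: "a1 \<in> A" "3 \<le> card (D a1)" by force
    obtain S where "S \<subseteq> D a1" "card S = 3" using obtain_subset_with_card_n[OF a1(2)] by metis
    then obtain b1 b2 b3 where "distinct [b1, b2, b3]" "{b1, b2, b3} \<subseteq> D a1"
      by (auto simp: card_3_iff)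
    hence "contains_copy K (tree_3 k)"
      using k a1 by (intro tree_3_copy[of k a1 b1 b2 b3]) (auto simp: D)
    hence cases: "T = tree_prime2 k \<or> T = tree_prime3 k" using T by auto
    have card1: "card (A - {a1}) = k - 5" using k a1(1) fin by simp
    show thesis
    proof (cases "T = tree_prime2 k")
      case True
      have "D a = {}" if "a \<in> A - {a1}" for a
      proof (rule ccontr)
        assume "D a \<noteq> {}"
        \<comment> \<open>Once \<open>b\<close> is fixed, \<open>D a1\<close> still offers two
          further vertices, since it has at least three elements.\<close>
        then obtain b where b: "b \<in> D a" by blast
        obtain b' where b': "b' \<in> D a1" "b' \<notin> {b}" using avoid[of "{b}" a1] a1(2) by auto
        obtain b'' where b'': "b'' \<in> D a1" "b'' \<notin> {b, b'}"
          using avoid[of "{b, b'}" a1] a1(2) b' by auto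
        have "contains_copy K (tree_prime2 k)"
          using k a1 that b b' b'' by (intro tree_prime2_copy[of k a1 a b' b'' b]) (auto simp: D)
        thus False using T True by simp
      qed
      thus thesis using card1 by (intro enough[of "A - {a1}" 0]) auto
    next
      case False
      hence T': "T = tree_prime3 k" using cases by simp
      show thesis
      proof (cases "\<forall>a\<in>A - {a1}. card (D a) \<le> 1")
        case True
        thus thesis using card1 k by (intro enough[of "A - {a1}" 1]) auto
      next
        case False
        then obtain a2 where a2: "a2 \<in> A - {a1}" "2 \<le> card (D a2)" by force
        have "D a = {}" if "a \<in> A - {a1, a2}" for a
        proof (rule ccontr)
          assume "D a \<noteq> {}"
          \<comment> \<open>The sets \<open>D a\<close>, \<open>D a2\<close>, \<open>D a1\<close>
            have at least 1, 2, 3 elements, so choosing from them in this order yields distinct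
            vertices.\<close>
          then obtain b where b: "b \<in> D a" by blast
          obtain b' where b': "b' \<in> D a2" "b' \<notin> {b}" using avoid[of "{b}" a2] a2(2) by auto
          obtain b'' where b'': "b'' \<in> D a1" "b'' \<notin> {b, b'}"
            using avoid[of "{b, b'}" a1] a1(2) b' by auto
          have "contains_copy K (tree_prime3 k)"
            using k a1 a2 that b b' b''
            by (intro tree_prime3_copy[of k a1 a2 a b'' b' b]) (auto simp: D)
          thus False using T T' by simp
        qed
        moreover have "card (A - {a1, a2}) = k - 6"
          using k a1(1) a2(1) fin by (auto simp: card_Diff_subset card_insert_if)
        ultimately show thesis by (intro enough[of "A - {a1, a2}" 0]) auto
      qed
    qed
  qed
qed

end

lemma path_copy:
  assumes "distinct xs" "set xs \<subseteq> verts K" "successively (\<lambda>x y. {x, y} \<in> edges K) xs"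
  shows "contains_copy K (path_P (length xs))"
proof (rule contains_copyI[OF simple_graph_grown_tree[OF grown_tree_path_P], of "(!) xs"])
  show "inj_on ((!) xs) (verts (path_P (length xs)))"
    using assms(1) by (auto simp: path_P_def intro!: inj_on_nth)
  show "(!) xs ` verts (path_P (length xs)) \<subseteq> verts K"
    using assms(2) by (auto simp: path_P_def)
  show "(!) xs ` e \<in> edges K" if "e \<in> edges (path_P (length xs))" for e
    using that assms(3) by (auto simp: path_P_def successively_conv_nth)
qed

section \<open>Trees in an almost complete bipartite graph\<close>

locale dense_bipartite =
  fixes K :: "'a graph" and A B :: "'a set" and c :: 'a and m :: nat
  assumes m: "9 \<le> m" and sub: "A \<subseteq> verts K" "B \<subseteq> verts K" and disj: "A \<inter> B = {}"
    and card_A: "card A = m - 2" and card_B: "card B = m - 2"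
    and c: "c \<in> B" "\<And>a. a \<in> A \<Longrightarrow> {c, a} \<in> edges K"
    and few: "\<And>a. a \<in> A \<Longrightarrow> card {b \<in> B. {a, b} \<notin> edges K} \<le> 2"
begin

lemma finite_parts: "finite A" "finite B"
  using card_A card_B m by (auto intro: card_ge_0_finite)

lemma nbr:
  assumes "a \<in> A" "card (X \<inter> B) + 2 < m - 2"
  obtains b where "b \<in> B" "b \<notin> X" "{a, b} \<in> edges K"
proof -
  have "\<not> B \<subseteq> X \<inter> B \<union> {b \<in> B. {a, b} \<notin> edges K}"
  proof
    assume "B \<subseteq> X \<inter> B \<union> {b \<in> B. {a, b} \<notin> edges K}"
    hence "card B \<le> card (X \<inter> B \<union> {b \<in> B. {a, b} \<notin> edges K})"
      using finite_parts by (intro card_mono) auto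
    also have "\<dots> \<le> card (X \<inter> B) + card {b \<in> B. {a, b} \<notin> edges K}" by (rule card_Un_le)
    finally show False using assms few card_B by fastforce
  qed
  thus thesis using that by auto
qed

text \<open>Two vertices of \<open>A\<close> together miss at most four vertices of
  \<open>B\<close>; the non-neighbours of \<open>a'\<close> are simply added to the forbidden
  set.\<close>

lemma common_nbr:
  assumes "a \<in> A" "a' \<in> A" "card (X \<inter> B) + 4 < m - 2"
  obtains b where "b \<in> B" "b \<notin> X" "{a, b} \<in> edges K" "{a', b} \<in> edges K"
proof -
  let ?Y = "X \<union> {b \<in> B. {a', b} \<notin> edges K}"
  have "?Y \<inter> B = X \<inter> B \<union> {b \<in> B. {a', b} \<notin> edges K}" by auto
  hence "card (?Y \<inter> B) \<le> card (X \<inter> B) + card {b \<in> B. {a', b} \<notin> edges K}"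
    by (simp add: card_Un_le)
  hence "card (?Y \<inter> B) + 2 < m - 2" using few[OF assms(2)] assms(3) by simp
  then obtain b where "b \<in> B" "b \<notin> ?Y" "{a, b} \<in> edges K" by (rule nbr[OF assms(1)])
  thus thesis using that by auto
qed

text \<open>Both ends are kept in \<open>A\<close>: the path grows through a common neighbour in
  \<open>B\<close> of its head and a new vertex of \<open>A\<close>, and at the end either side can
  still be prolonged into \<open>B\<close>.\<close>

lemma alternating_path:
  assumes "i + 6 \<le> m"
  shows "\<exists>xs. distinct xs \<and> set xs \<subseteq> A \<union> B \<and> xs \<noteq> [] \<and> hd xs \<in> A \<and> last xs \<in> A \<and>
    successively (\<lambda>x y. {x, y} \<in> edges K) xs \<and> card (set xs \<inter> A) = Suc i \<and> card (set xs \<inter> B) = i"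
  using assms
proof (induction i)
  case 0
  obtain a where a: "a \<in> A" using card_A m by fastforce
  hence "{a} \<inter> B = {}" using disj by auto
  thus ?case using a by (intro exI[of _ "[a]"]) simp
next
  case (Suc i)
  then obtain xs where xs: "distinct xs" "set xs \<subseteq> A \<union> B" "xs \<noteq> []" "hd xs \<in> A" "last xs \<in> A"
    "successively (\<lambda>x y. {x, y} \<in> edges K) xs" "card (set xs \<inter> A) = Suc i" "card (set xs \<inter> B) = i"
    by auto
  have "\<not> A \<subseteq> set xs"
  proof
    assume "A \<subseteq> set xs"
    hence "set xs \<inter> A = A" by auto
    thus False using xs(7) card_A Suc.prems by simp
  qed
  then obtain a where a: "a \<in> A" "a \<notin> set xs" by auto
  obtain b where b: "b \<in> B" "b \<notin> set xs" "{a, b} \<in> edges K" "{hd xs, b} \<in> edges K"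
    by (rule common_nbr[OF a(1) xs(4), of "set xs"]) (use xs(8) Suc.prems in auto)
  have ab: "a \<notin> B" "b \<notin> A" using a b disj by auto
  show ?case
    by (rule exI[of _ "a # b # xs"])
      (use a b ab xs in \<open>auto simp: successively_Cons insert_commute Int_insert_left\<close>)
qed

lemma path_P_in: "contains_copy K (path_P m)"
proof -
  \<comment> \<open>The alternating path has \<open>2 * t + 1\<close> vertices; one more vertex of
    \<open>B\<close> settles even \<open>m\<close>, one at each end settles odd \<open>m\<close>.
    For \<open>m = 9\<close> the inequality \<open>t + 6 \<le> m\<close> is tight.\<close>
  define t where "t = m div 2 - 1"
  have t: "t + 6 \<le> m" "m = 2 * t + 2 \<or> m = 2 * t + 3" using m by (auto simp: t_def)
  obtain xs where xs: "distinct xs" "set xs \<subseteq> A \<union> B" "xs \<noteq> []" "hd xs \<in> A" "last xs \<in> A"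
    "successively (\<lambda>x y. {x, y} \<in> edges K) xs" "card (set xs \<inter> A) = Suc t" "card (set xs \<inter> B) = t"
    using alternating_path[OF t(1)] by auto
  have "card (set xs) = card (set xs \<inter> A \<union> set xs \<inter> B)" using xs(2) by (intro arg_cong[of _ _ card]) auto
  also have "\<dots> = Suc t + t" using xs(7,8) disj by (subst card_Un_disjoint) auto
  finally have len: "length xs = 2 * t + 1" using xs(1) by (simp add: distinct_card)
  obtain b where b: "b \<in> B" "b \<notin> set xs" "{hd xs, b} \<in> edges K"
    by (rule nbr[OF xs(4), of "set xs"]) (use xs(8) t in auto)
  have "card (insert b (set xs) \<inter> B) = Suc t" using b xs(8) by (simp add: Int_insert_left)
  hence "card (insert b (set xs) \<inter> B) + 2 < m - 2" using t m by auto
  then obtain b' where b': "b' \<in> B" "b' \<notin> insert b (set xs)" "{last xs, b'} \<in> edges K"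
    by (rule nbr[OF xs(5)])
  have even: "contains_copy K (path_P (length (b # xs)))"
    using b xs sub by (intro path_copy) (auto simp: successively_Cons insert_commute)
  have odd: "contains_copy K (path_P (length (b # xs @ [b'])))"
    using b b' xs sub
    by (intro path_copy) (auto simp: successively_Cons successively_append_iff insert_commute)
  have "length (b # xs) = 2 * t + 2" "length (b # xs @ [b']) = 2 * t + 3" using len by simp_all
  thus ?thesis using t(2) even odd by metis
qed

lemma contains_all_trees:
  assumes "G \<in> {path_P m, tree_prime m, tree_star m, tree_1 m, tree_2 m, tree_3 m,
               tree_prime2 m, tree_prime3 m}"
  shows "contains_copy K G"
proof -
  have k: "7 \<le> m" using m by simp
  have "c \<notin> A" using c(1) disj by auto
  then interpret star_in_graph K c A
    using finite_parts c sub by unfold_locales auto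
  have out: "b \<in> verts K - insert c S" if "b \<in> B" "b \<noteq> c" "S \<subseteq> A" for b S
    using that sub disj by auto
  have "3 \<le> card A" using card_A m by simp
  then obtain S where "S \<subseteq> A" "card S = 3" using obtain_subset_with_card_n by metis
  then obtain a1 a2 a3 where a: "distinct [a1, a2, a3]" "{a1, a2, a3} \<subseteq> A"
    by (auto simp: card_3_iff)
  \<comment> \<open>Trees whose hub has degree \<open>m - 3\<close> or \<open>m - 4\<close> need
    stars of exactly that size, hence the smaller sets \<open>A3\<close> and \<open>A4\<close>,
    which retain the vertices where further edges are attached.\<close>
  have "\<exists>S. {a1, a2} \<subseteq> S \<and> S \<subseteq> A \<and> card S = m - 3"
    by (rule exists_subset_between) (use a card_A m finite_parts in auto)
  then obtain A3 where A3: "{a1, a2} \<subseteq> A3" "A3 \<subseteq> A" "card A3 = m - 3" by auto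
  have "\<exists>S. {a1, a2, a3} \<subseteq> S \<and> S \<subseteq> A \<and> card S = m - 4"
    by (rule exists_subset_between) (use a card_A m finite_parts in auto)
  then obtain A4 where A4: "{a1, a2, a3} \<subseteq> A4" "A4 \<subseteq> A" "card A4 = m - 4" by auto
  interpret A3: star_in_graph K c A3 by (rule star_in_graph_subset[OF A3(2)])
  interpret A4: star_in_graph K c A4 by (rule star_in_graph_subset[OF A4(2)])
  have small: "card (set ys \<inter> B) + 2 < m - 2" if "length ys \<le> 3" for ys :: "'a list"
  proof -
    have "card (set ys \<inter> B) \<le> card (set ys)" by (intro card_mono) auto
    thus ?thesis using that card_length[of ys] m by linarith
  qed
  obtain b1 where b1: "b1 \<in> B" "b1 \<notin> set [c]" "{a1, b1} \<in> edges K"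
    by (rule nbr[of a1 "set [c]"]) (use a small[of "[c]"] in auto)
  obtain b2 where b2: "b2 \<in> B" "b2 \<notin> set [c, b1]" "{a1, b2} \<in> edges K"
    by (rule nbr[of a1 "set [c, b1]"]) (use a small[of "[c, b1]"] in auto)
  obtain b3 where b3: "b3 \<in> B" "b3 \<notin> set [c, b1, b2]" "{a1, b3} \<in> edges K"
    by (rule nbr[of a1 "set [c, b1, b2]"]) (use a small[of "[c, b1, b2]"] in auto)
  \<comment> \<open>The \<open>b\<close>'s hang from \<open>a1\<close> alone. The \<open>d\<close>'s
    extend \<open>b1\<close> to a matching from \<open>a1\<close>, \<open>a2\<close>,
    \<open>a3\<close>, and \<open>e2\<close> avoids both \<open>b1\<close> and \<open>b2\<close> as
    required by \<open>tree_prime2\<close>.\<close>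
  obtain d2 where d2: "d2 \<in> B" "d2 \<notin> set [c, b1]" "{a2, d2} \<in> edges K"
    by (rule nbr[of a2 "set [c, b1]"]) (use a small[of "[c, b1]"] in auto)
  obtain d3 where d3: "d3 \<in> B" "d3 \<notin> set [c, b1, d2]" "{a3, d3} \<in> edges K"
    by (rule nbr[of a3 "set [c, b1, d2]"]) (use a small[of "[c, b1, d2]"] in auto)
  obtain e2 where e2: "e2 \<in> B" "e2 \<notin> set [c, b1, b2]" "{a2, e2} \<in> edges K"
    by (rule nbr[of a2 "set [c, b1, b2]"]) (use a small[of "[c, b1, b2]"] in auto)
  have tree_prime: "contains_copy K (tree_prime m)"
    using a b1 out card_A by (intro tree_prime_copy[OF k, of a1 b1]) auto
  have tree_1: "contains_copy K (tree_1 m)"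
    using a b1 d2 A3 out by (intro A3.tree_1_copy[OF k, of a1 a2 b1 d2]) auto
  have tree_2: "contains_copy K (tree_2 m)"
    using a b1 b2 A3 out by (intro A3.tree_2_copy[OF k, of a1 b1 b2]) auto
  have tree_3: "contains_copy K (tree_3 m)"
    using a b1 b2 b3 A4 out by (intro A4.tree_3_copy[OF k, of a1 b1 b2 b3]) auto
  have tree_prime2: "contains_copy K (tree_prime2 m)"
    using a b1 b2 e2 A4 out by (intro A4.tree_prime2_copy[OF k, of a1 a2 b1 b2 e2]) auto
  have tree_prime3: "contains_copy K (tree_prime3 m)"
    using a b1 d2 d3 A4 out by (intro A4.tree_prime3_copy[OF k, of a1 a2 a3 b1 d2 d3]) auto
  have tree_star: "contains_copy K (tree_star m)"
  proof -
    \<comment> \<open>The tail of \<open>tree_star\<close> runs from \<open>a1\<close> through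
      \<open>B\<close> back to \<open>a2\<close>, which is therefore removed from the star; this
      leaves \<open>m - 3\<close> neighbours of the hub.\<close>
    have "a1 \<in> A" "a2 \<in> A" "a1 \<noteq> a2" using a by auto
    obtain b where b: "b \<in> B" "b \<notin> {c}" "{a1, b} \<in> edges K" "{a2, b} \<in> edges K"
      by (rule common_nbr[OF \<open>a1 \<in> A\<close> \<open>a2 \<in> A\<close>, of "{c}"]) (use c m in auto)
    interpret A2: star_in_graph K c "A - {a2}" by (rule star_in_graph_subset) auto
    have "b \<noteq> a2" "a2 \<noteq> c" using b \<open>a2 \<in> A\<close> disj c by auto
    thus ?thesis
      using b \<open>a1 \<in> A\<close> \<open>a2 \<in> A\<close> \<open>a1 \<noteq> a2\<close> card_A finite_parts sub disj
      by (intro A2.tree_star_copy[OF k, of a1 b a2]) (auto simp: insert_commute)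
  qed
  show ?thesis
    using assms path_P_in tree_prime tree_star tree_1 tree_2 tree_3 tree_prime2 tree_prime3 by blast
qed

end

section \<open>Upper bound\<close>

text \<open>The surplus \<open>j\<close> in \<open>card A\<close> compensates for the at most
  \<open>j\<close> vertices of \<open>A\<close> not adjacent to the chosen hub
  \<open>c\<close>.\<close>

lemma contains_all_trees_if_sparse_complement:
  assumes m: "9 \<le> m" and sub: "A \<subseteq> verts K" "B \<subseteq> verts K" and disj: "A \<inter> B = {}"
    and j: "j \<le> 2" and card_A: "card A = m - 2 + j" and card_B: "card B = m - 2"
    and few: "\<And>a. a \<in> A \<Longrightarrow> card {b \<in> B. {a, b} \<notin> edges K} \<le> j"
    and G: "G \<in> {path_P m, tree_prime m, tree_star m, tree_1 m, tree_2 m, tree_3 m,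
               tree_prime2 m, tree_prime3 m}"
  shows "contains_copy K G"
proof -
  have fin: "finite A" "finite B" using card_A card_B m by (auto intro: card_ge_0_finite)
  have "\<exists>c\<in>B. card {a \<in> A. {a, c} \<notin> edges K} \<le> j"
  proof (rule ccontr)
    assume "\<not> ?thesis"
    hence "(\<Sum>c\<in>B. Suc j) \<le> (\<Sum>c\<in>B. card {a \<in> A. {a, c} \<notin> edges K})"
      by (intro sum_mono) (auto simp: not_le Suc_le_eq)
    also have "\<dots> = (\<Sum>a\<in>A. card {b \<in> B. {a, b} \<notin> edges K})"
      by (rule sum_multicount_gen) (use fin in auto)
    also have "\<dots> \<le> (\<Sum>a\<in>A. j)" using few by (intro sum_mono) auto
    \<comment> \<open>The non-adjacent pairs are counted from both sides. Cancelling
      \<open>(m - 2) * j\<close> leaves \<open>m - 2 \<le> j * j \<le> 4\<close>, impossible for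
      \<open>m \<ge> 9\<close>.\<close>
    finally have "(m - 2) * Suc j \<le> (m - 2 + j) * j" using card_A card_B by simp
    hence "m - 2 \<le> j * j" by (simp add: add_mult_distrib)
    moreover have "j * j \<le> 4" using mult_le_mono[OF j j] by simp
    ultimately show False using m by simp
  qed
  then obtain c where c: "c \<in> B" "card {a \<in> A. {a, c} \<notin> edges K} \<le> j" by auto
  have "card A = card {a \<in> A. {a, c} \<in> edges K} + card {a \<in> A. {a, c} \<notin> edges K}"
    by (subst card_Un_disjoint[symmetric]) (use fin in \<open>auto intro!: arg_cong[of _ _ card]\<close>)
  hence "m - 2 \<le> card {a \<in> A. {a, c} \<in> edges K}" using c card_A by simp
  then obtain A' where A': "A' \<subseteq> {a \<in> A. {a, c} \<in> edges K}" "card A' = m - 2" "finite A'"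
    by (rule obtain_subset_with_card_n)
  have few': "card {b \<in> B. {a, b} \<notin> edges K} \<le> 2" if "a \<in> A'" for a
    using few[of a] A'(1) j that by auto
  interpret dense_bipartite K A' B c m
    using m sub disj A' card_B c few' by unfold_locales (auto simp: insert_commute)
  show ?thesis by (rule contains_all_trees[OF G])
qed

lemma grown_tree_if_mem:
  assumes "7 \<le> k" "G \<in> {path_P k, tree_prime k, tree_star k, tree_1 k, tree_2 k, tree_3 k,
               tree_prime2 k, tree_prime3 k}"
  shows "grown_tree k G"
  using assms grown_tree_path_P grown_tree_trees by blast

lemma contains_copy_or_complement_contains_copy:
  fixes K :: "'a graph"
  assumes m: "9 \<le> m" and mn: "m + 4 \<le> n"
    and G: "G \<in> {path_P m, tree_prime m, tree_star m, tree_1 m, tree_2 m, tree_3 m,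
               tree_prime2 m, tree_prime3 m}"
    and T: "T \<in> {tree_prime2 n, tree_prime3 n, tree_3 n}"
    and K: "simple_graph K" "card (verts K) = m + n - 5"
  shows "contains_copy K G \<or> contains_copy (complement K) T"
proof (rule disjCI)
  assume no_T: "\<not> contains_copy (complement K) T"
  have fin: "finite (verts K)" using K(1) by (simp add: simple_graph_def)
  have co: "{x, y} \<in> edges (complement K) \<longleftrightarrow>
      x \<in> verts K \<and> y \<in> verts K \<and> x \<noteq> y \<and> {x, y} \<notin> edges K" for x y
    by (auto simp: complement_def nsets_def card_insert_if)
  have co_verts: "verts (complement K) = verts K" by (simp add: complement_def)
  define N where "N x = {y \<in> verts K. {x, y} \<in> edges (complement K)}" for x
  show "contains_copy K G"
  proof (cases "\<exists>x\<in>verts K. n - 4 \<le> card (N x)")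
    case False
    show ?thesis
    proof (rule grown_tree_copy_if_min_degree[OF grown_tree_if_mem[OF _ G] K(1)])
      show "7 \<le> m" using m by simp
      show "verts K \<noteq> {}" using K(2) m by auto
      fix x assume x: "x \<in> verts K"
      let ?M = "{y \<in> verts K. {x, y} \<in> edges K}"
      \<comment> \<open>With at most \<open>n - 5\<close> non-neighbours besides \<open>x\<close>
        itself, at least \<open>(m + n - 5) - (n - 4) = m - 1\<close> neighbours remain.\<close>
      have "verts K = insert x (N x) \<union> ?M" using x by (auto simp: N_def co)
      hence "card (verts K) \<le> card (insert x (N x)) + card ?M" by (metis card_Un_le)
      also have "card (insert x (N x)) \<le> Suc (card (N x))" by (rule card_insert_le_m1) auto
      finally have "card (verts K) \<le> Suc (card (N x)) + card ?M" by simp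
      moreover have "card (N x) < n - 4" using False x by (auto simp: not_le)
      ultimately show "m - 1 \<le> card ?M" using K(2) mn by linarith
    qed
  next
    case True
    then obtain v where v: "v \<in> verts K" "n - 4 \<le> card (N v)" by auto
    \<comment> \<open>\<open>n - 4\<close> is the degree of vertex 0 in each of the three possible
      \<open>T\<close>.\<close>
    then obtain A where A: "A \<subseteq> N v" "card A = n - 4" "finite A"
      using obtain_subset_with_card_n[OF v(2)] by blast
    have AN: "v \<notin> A" "A \<subseteq> verts K" using A(1) by (auto simp: N_def co)
    interpret S: star_in_graph "complement K" v A
      using A AN v fin by unfold_locales (auto simp: N_def co_verts intro: finite_subset)
    define B where "B = verts K - insert v A"
    have "7 \<le> n" "finite (verts (complement K))" using mn m fin by (simp_all add: co_verts)
    note sparse = S.sparse_leaves_if_tree_free[OF this(1) A(2) this(2) T no_T, unfolded co_verts,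
        folded B_def]
    obtain S j where S: "S \<subseteq> A" "j \<le> 2" "card S = n - 6 + j"
      "\<And>a. a \<in> S \<Longrightarrow> card {b \<in> B. {a, b} \<in> edges (complement K)} \<le> j"
      by (rule sparse) blast
    \<comment> \<open>Here \<open>m + 4 \<le> n\<close> enters, as
      \<open>m - 2 \<le> n - 6\<close>.\<close>
    have "m - 2 + j \<le> card S" using S(3) mn by simp
    then obtain S' where S': "S' \<subseteq> S" "card S' = m - 2 + j" "finite S'"
      by (rule obtain_subset_with_card_n)
    show ?thesis
    proof (rule contains_all_trees_if_sparse_complement[OF m _ _ _ S(2) S'(2) _ _ G])
      show "S' \<subseteq> verts K" "B \<subseteq> verts K" "S' \<inter> B = {}"
        using S'(1) S(1) AN by (auto simp: B_def)
      show "card B = m - 2"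
        using AN v A(2) K(2) mn fin finite_subset[OF AN(2) fin]
        by (simp add: B_def card_Diff_subset)
      fix a assume a: "a \<in> S'"
      have "{b \<in> B. {a, b} \<notin> edges K} = {b \<in> B. {a, b} \<in> edges (complement K)}"
        using a S'(1) S(1) AN by (auto simp: co B_def)
      thus "card {b \<in> B. {a, b} \<notin> edges K} \<le> j" using S(4) a S'(1) by auto
    qed
  qed
qed

section \<open>Lower bound\<close>

text \<open>Disjoint cliques on consecutive blocks of \<open>q\<close> numbers. The last block may
  be cut short, so one construction refutes every \<open>N\<close> below the claimed value.\<close>

definition block_graph :: "nat \<Rightarrow> nat \<Rightarrow> nat graph" where
  "block_graph q N = \<lparr>verts = {0..<N},
     edges = {{x, y} | x y. x < N \<and> y < N \<and> x \<noteq> y \<and> x div q = y div q}\<rparr>"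

lemma simple_graph_block_graph: "simple_graph (block_graph q N)"
  by (auto simp: block_graph_def simple_graph_def nsets_def card_insert_if)

lemma block_eq:
  fixes d :: nat
  assumes "0 < q"
  shows "{y. y div q = d} = {d * q..<d * q + q}"
proof (intro set_eqI iffI)
  fix y assume "y \<in> {y. y div q = d}"
  thus "y \<in> {d * q..<d * q + q}"
    using dividend_less_div_times[OF assms, of y] by (auto simp: add.commute)
next
  fix y assume "y \<in> {d * q..<d * q + q}"
  thus "y \<in> {y. y div q = d}" by (intro CollectI div_nat_eqI) (auto simp: algebra_simps)
qed

text \<open>Following parents down to vertex 0 keeps a copy inside a single block, which has only
  \<open>q < k\<close> numbers.\<close>

lemma no_grown_tree_in_block_graph:
  assumes "grown_tree k H" "0 < q" "q < k"
  shows "\<not> contains_copy (block_graph q N) H"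
proof
  assume "contains_copy (block_graph q N) H"
  then obtain f where f: "inj_on f (verts H)"
    and edge: "\<And>u v. u \<in> verts H \<Longrightarrow> v \<in> verts H \<Longrightarrow> {u, v} \<in> edges H \<Longrightarrow>
        {f u, f v} \<in> edges (block_graph q N)"
    by (rule contains_copyE) blast
  from assms(1) obtain par where V: "verts H = {0..<k}" and par: "\<forall>i\<in>{1..<k}. par i < i"
    and E: "edges H = (\<lambda>i. {par i, i}) ` {1..<k}"
    unfolding grown_tree_def by auto
  have same: "f i div q = f 0 div q" if "i < k" for i
    using that
  proof (induction i rule: less_induct)
    case (less i)
    show ?case
    proof (cases "i = 0")
      case False
      hence p: "par i < i" "{par i, i} \<in> edges H" using par E less.prems by auto
      hence "{f (par i), f i} \<in> edges (block_graph q N)"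
        using edge less.prems V by auto
      hence "f (par i) div q = f i div q" by (auto simp: block_graph_def doubleton_eq_iff)
      thus ?thesis using less.IH[OF p(1)] p(1) less.prems by simp
    qed simp
  qed
  have "f ` {0..<k} \<subseteq> {y. y div q = f 0 div q}"
    by (intro image_subsetI CollectI same) simp
  hence "card (f ` {0..<k}) \<le> card {y. y div q = f 0 div q}"
    using assms(2) by (intro card_mono) (auto simp: block_eq)
  thus False using f V assms(2,3) by (simp add: card_image block_eq)
qed

text \<open>In the complement, the neighbours of \<open>f 0\<close> avoid its block. Counting inside
  \<open>{0..<M}\<close> rather than \<open>{0..<N}\<close> makes that block complete, since
  \<open>q\<close> divides \<open>M\<close>, so at most \<open>M - q\<close> places remain.\<close>

lemma no_large_star_in_block_graph_complement:
  assumes T: "verts T = {0..<n}" "star_edges d \<subseteq> edges T" "d < n"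
    and q: "0 < q" "q dvd M" "N \<le> M" "M - q < d"
  shows "\<not> contains_copy (complement (block_graph q N)) T"
proof
  assume "contains_copy (complement (block_graph q N)) T"
  then obtain f where f: "inj_on f (verts T)" "f ` verts T \<subseteq> verts (complement (block_graph q N))"
    and edge: "\<And>u v. u \<in> verts T \<Longrightarrow> v \<in> verts T \<Longrightarrow> {u, v} \<in> edges T \<Longrightarrow>
        {f u, f v} \<in> edges (complement (block_graph q N))"
    by (rule contains_copyE) blast
  have lt: "f i < N" if "i < n" for i
    using f(2) that T(1) by (auto simp: complement_def block_graph_def image_subset_iff)
  let ?B = "{f 0 div q * q..<f 0 div q * q + q}"
  have "f i \<in> {0..<M} - ?B" if i: "i \<in> {1..d}" for i
  proof -
    have "{0, i} \<in> star_edges d" using i by (auto simp: star_edges_def)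
    hence "{f 0, f i} \<in> edges (complement (block_graph q N))" using edge T i by auto
    hence "f 0 div q \<noteq> f i div q"
      using lt[of 0] lt[of i] i T(3)
      by (auto simp: complement_def block_graph_def nsets_def card_insert_if split: if_splits)
    moreover have "f i < M" using lt[of i] i T(3) q(3) by auto
    ultimately show ?thesis unfolding block_eq[OF q(1), symmetric] by simp
  qed
  hence "f ` {1..d} \<subseteq> {0..<M} - ?B" by auto
  hence "card (f ` {1..d}) \<le> card ({0..<M} - ?B)" by (intro card_mono) auto
  moreover have "card (f ` {1..d}) = d"
    using inj_on_subset[OF f(1), of "{1..d}"] T by (simp add: card_image subset_iff)
  moreover have "card ({0..<M} - ?B) = M - q"
  proof -
    obtain s where s: "M = q * s" using q(2) by auto
    have "f 0 < M" using lt[of 0] T(3) q(3) by auto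
    hence "f 0 div q < s" using s by (simp add: less_mult_imp_div_less mult.commute)
    hence "Suc (f 0 div q) * q \<le> s * q" by (intro mult_le_mono1) simp
    hence "?B \<subseteq> {0..<M}" using s by (auto simp: mult.commute)
    thus ?thesis by (simp add: card_Diff_subset)
  qed
  ultimately show False using q(4) by simp
qed

theorem theorem5p1:
  fixes m n :: nat and G T :: "nat graph"
  assumes "n \<ge> 15" and "m \<ge> 9" and "(m - 1) dvd (n - 5)"
    and "G \<in> {path_P m, tree_prime m, tree_star m, tree_1 m, tree_2 m, tree_3 m,
               tree_prime2 m, tree_prime3 m}"
    and "T \<in> {tree_prime2 n, tree_prime3 n, tree_3 n}"
  shows "ramsey_number G T = m + n - 5"
proof -
  have "m - 1 \<le> n - 5" using assms(1,3) by (intro dvd_imp_le) auto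
  hence mn: "m + 4 \<le> n" using assms(1,2) by simp
  have T: "verts T = {0..<n}" "star_edges (n - 4) \<subseteq> edges T"
    using assms(5) by (auto simp: tree_prime2_def tree_prime3_def tree_3_def)
  have G: "grown_tree m G" using assms(2,4) by (intro grown_tree_if_mem) auto
  show ?thesis
    unfolding ramsey_number_def
  proof (rule Least_equality)
    show "m + n - 5 > 0 \<and> (\<forall>K :: nat graph. simple_graph K \<and> card (verts K) = m + n - 5 \<longrightarrow>
        contains_copy K G \<or> contains_copy (complement K) T)"
      using contains_copy_or_complement_contains_copy[OF assms(2) mn assms(4,5)] assms(1) by auto
  next
    fix N assume N: "N > 0 \<and> (\<forall>K :: nat graph. simple_graph K \<and> card (verts K) = N \<longrightarrow>
        contains_copy K G \<or> contains_copy (complement K) T)"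
    show "m + n - 5 \<le> N"
    proof (rule ccontr)
      \<comment> \<open>\<open>?M\<close> is one less than the claimed Ramsey number and, by the
        divisibility hypothesis, a multiple of \<open>?q\<close>; moreover
        \<open>?M - ?q = n - 5\<close> is just below the hub degree \<open>n - 4\<close>.\<close>
      let ?q = "m - 1" and ?M = "(n - 5) + (m - 1)"
      assume "\<not> m + n - 5 \<le> N"
      hence "N \<le> ?M" using assms(1,2) by simp
      moreover have "?q dvd ?M" using assms(3) by simp
      ultimately have "\<not> contains_copy (complement (block_graph ?q N)) T"
        using T assms(1,2) by (intro no_large_star_in_block_graph_complement) auto
      moreover have "\<not> contains_copy (block_graph ?q N) G"
        using assms(2) by (intro no_grown_tree_in_block_graph[OF G]) auto
      moreover have "card (verts (block_graph ?q N)) = N" by (simp add: block_graph_def)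
      ultimately show False using N simple_graph_block_graph by blast
    qed
  qed
qed

end
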